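(* Non-generic ordered right-angled hexagons of type 2 in the Siegel space of $\mathrm{Sp}(4,\mathbb R)$ are parametrized up to isometry by $$\mathcal H^{nongen}_{type2.1}/\mathrm{PSp}(4,\mathbb R)\cong\mathfrak d^2\times\mathfrak a,\qquad \mathcal H^{nongen}_{type2.2}/\mathrm{PSp}(4,\mathbb R)\cong\mathfrak d\times\mathfrak a\times\mathfrak d,\qquad \mathcal H^{nongen}_{type2.3}/\mathrm{PSp}(4,\mathbb R)\cong\mathfrak a\times\mathfrak d^2;$$ that is, in each case the map $[(P,A,B,C,D,Q)]\mapsto(\underline b,\underline c,\underline d)$ given by the length parameters is a bijection.
   Context: $\mathrm{PSp}(4,\mathbb R)=\mathrm{Sp}(4,\mathbb R)/\{\pm\mathrm{Id}\}$ where $\mathrm{Sp}(4,\mathbb R)$ preserves the form with matrix $\begin{pmatrix}0&\mathrm{Id}\\-\mathrm{Id}&0\end{pmatrix}$. A real symmetric matrix $X$ denotes the Lagrangian of $\mathbb R^4$ spanned by the columns of $\binom{X}{\mathrm{Id}}$, and $\infty=\langle e_1,e_2\rangle$. A triple of pairwise transverse Lagrangians is maximal if it is in the $\mathrm{Sp}(4,\mathbb R)$-orbit of $(\infty,0,\mathrm{Id})$ (so $(\infty,X,Y)$ is maximal iff $Y-X$ is positive definite); an $m$-tuple is maximal if all its subtriples with increasing indices are. Cross-ratio: $R(l_1,l_2,l_3,l_4)=p_{l_1}^{\|l_2}\circ p_{l_4}^{\|l_3}|_{l_1}$, where $p_l^{\|l'}$ is the projection to $l$ parallel to $l'$ (e.g.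 $R(0,Z,X,\infty)=Z^{-1}X$). A maximal quadruple $(P,X,Y,Q)$ is generic if the two eigenvalues of $R(P,X,Y,Q)$ are distinct and non-generic if they are equal. An ordered right-angled hexagon (a cyclic sequence of six consecutively orthogonal $\mathbb R$-tubes of the Siegel space with a chosen first tube) is uniquely determined by, and identified with, a maximal 6-tuple $(P,A,B,C,D,Q)$ of Lagrangians. $\mathcal H^{nongen}_{type2.1}$, $\mathcal H^{nongen}_{type2.2}$, $\mathcal H^{nongen}_{type2.3}$ are the sets of maximal $(P,A,B,C,D,Q)$ such that exactly one of the quadruples $(P,A,B,Q),(P,B,C,Q),(P,C,D,Q)$ is generic, namely $(P,C,D,Q)$ for type 2.1, $(P,B,C,Q)$ for type 2.2, $(P,A,B,Q)$ for type 2.3. Length parameters: for a maximal quadruple $(P,X,Y,Q)$ the Weyl-chamber-valued distance between the orthogonal projections of $X$ and $Y$ to the tube $\mathcal Y_{P,Q}$ is $(\log\mu_1,\log\mu_2)$ with $\mu_1\ge\mu_2$ the eigenvalues of $R(P,X,Y,Q)$; $\underline b,\underline c,\underline d$ are these vectors for $(P,A,B,Q)$, $(P,B,C,Q)$, $(P,C,D,Q)$ respectively. $\mathfrak a=\{(x_1,x_2):x_1>x_2>0\}$, $\mathfrak d=\{(x_1,x_2):x_1=x_2>0\}$. *)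

theory Defs
  imports "HOL-Analysis.Analysis" "HOL-Algebra.Group_Action"
begin

definition symp_mat :: "real^4^4" where
  "symp_mat = vector [vector [ 0,  0, 1, 0],
                      vector [ 0,  0, 0, 1],
                      vector [-1,  0, 0, 0],
                      vector [ 0, -1, 0, 0]]"

definition symp_form :: "real^4 \<Rightarrow> real^4 \<Rightarrow> real" where
  "symp_form x y = x \<bullet> (symp_mat *v y)"

definition Sp4 :: "(real^4^4) monoid" where
  "Sp4 = \<lparr>carrier = {g. transpose g ** symp_mat ** g = symp_mat}, mult = (**), one = mat 1\<rparr>"

definition PSp4 :: "(real^4^4) set monoid" where
  "PSp4 = Sp4 Mod {mat 1, - mat 1}"

definition lagrangian :: "(real^4) set \<Rightarrow> bool" where
  "lagrangian l \<longleftrightarrow> subspace l \<and> dim l = 2 \<and> (\<forall>x\<in>l. \<forall>y\<in>l. symp_form x y = 0)"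

definition transverse :: "(real^4) set \<Rightarrow> (real^4) set \<Rightarrow> bool" where
  "transverse l l' \<longleftrightarrow> l \<inter> l' = {0}"

definition lag_infinity :: "(real^4) set" where
  "lag_infinity = span {axis 1 1, axis 2 1}"

text \<open>The matrix argument of \<^const>\<open>columns\<close> is the 4 by 2 block matrix with
  upper block \<open>X\<close> and lower block the identity. The result is Lagrangian exactly when \<open>X\<close> is symmetric.\<close>

definition lag_of :: "real^2^2 \<Rightarrow> (real^4) set" where
  "lag_of X = span (columns (vector [row 1 X, row 2 X, row 1 (mat 1), row 2 (mat 1)] :: real^2^4))"

definition maximal_triple :: "(real^4) set \<Rightarrow> (real^4) set \<Rightarrow> (real^4) set \<Rightarrow> bool" where
  "maximal_triple l1 l2 l3 \<longleftrightarrow>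
     lagrangian l1 \<and> lagrangian l2 \<and> lagrangian l3 \<and>
     transverse l1 l2 \<and> transverse l2 l3 \<and> transverse l1 l3 \<and>
     (\<exists>g\<in>carrier Sp4. l1 = (*v) g ` lag_infinity \<and> l2 = (*v) g ` lag_of 0 \<and> l3 = (*v) g ` lag_of (mat 1))"

text \<open>Only meaningful for lists of length at least 3.\<close>

definition maximal_tuple :: "(real^4) set list \<Rightarrow> bool" where
  "maximal_tuple ls \<longleftrightarrow>
     (\<forall>i j k. i < j \<and> j < k \<and> k < length ls \<longrightarrow> maximal_triple (ls ! i) (ls ! j) (ls ! k))"

definition proj_along :: "(real^4) set \<Rightarrow> (real^4) set \<Rightarrow> real^4 \<Rightarrow> real^4" where
  "proj_along l l' v = (THE u. u \<in> l \<and> v - u \<in> l')"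

definition cross_ratio ::
    "(real^4) set \<Rightarrow> (real^4) set \<Rightarrow> (real^4) set \<Rightarrow> (real^4) set \<Rightarrow> real^4 \<Rightarrow> real^4" where
  "cross_ratio l1 l2 l3 l4 = restrict (proj_along l1 l2 \<circ> proj_along l4 l3) l1"

definition cr_eigenvalues ::
    "(real^4) set \<Rightarrow> (real^4) set \<Rightarrow> (real^4) set \<Rightarrow> (real^4) set \<Rightarrow> real set" where
  "cr_eigenvalues P X Y Q = {\<mu>. \<exists>v\<in>P. v \<noteq> 0 \<and> cross_ratio P X Y Q v = \<mu> *\<^sub>R v}"

text \<open>For a maximal quadruple, \<open>cross_ratio P X Y Q\<close> is an endomorphism of the plane \<open>P\<close> with
  two real positive eigenvalues, counted with multiplicity. The set \<open>cr_eigenvalues P X Y Q\<close> has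
  cardinality 2 if they are distinct and 1 if they coincide; in both cases its maximum and minimum
  are the larger and the smaller eigenvalue.\<close>

definition generic :: "(real^4) set \<Rightarrow> (real^4) set \<Rightarrow> (real^4) set \<Rightarrow> (real^4) set \<Rightarrow> bool" where
  "generic P X Y Q \<longleftrightarrow> card (cr_eigenvalues P X Y Q) = 2"

definition weyl_length ::
    "(real^4) set \<Rightarrow> (real^4) set \<Rightarrow> (real^4) set \<Rightarrow> (real^4) set \<Rightarrow> real \<times> real" where
  "weyl_length P X Y Q = (ln (Max (cr_eigenvalues P X Y Q)), ln (Min (cr_eigenvalues P X Y Q)))"

definition weyl_regular :: "(real \<times> real) set" where
  "weyl_regular = {(x1, x2). x1 > x2 \<and> x2 > 0}"

definition weyl_diagonal :: "(real \<times> real) set" where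
  "weyl_diagonal = {(x1, x2). x1 = x2 \<and> x2 > 0}"

text \<open>An ordered right-angled hexagon is identified with the maximal 6-tuple
  \<open>(P, A, B, C, D, Q)\<close> of Lagrangians that determines it.\<close>

type_synonym hexagon =
  "(real^4) set \<times> (real^4) set \<times> (real^4) set \<times> (real^4) set \<times> (real^4) set \<times> (real^4) set"

definition hex_type2_1 :: "hexagon set" where
  "hex_type2_1 = {(P, A, B, C, D, Q). maximal_tuple [P, A, B, C, D, Q] \<and>
     \<not> generic P A B Q \<and> \<not> generic P B C Q \<and> generic P C D Q}"

definition hex_type2_2 :: "hexagon set" where
  "hex_type2_2 = {(P, A, B, C, D, Q). maximal_tuple [P, A, B, C, D, Q] \<and>
     \<not> generic P A B Q \<and> generic P B C Q \<and> \<not> generic P C D Q}"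

definition hex_type2_3 :: "hexagon set" where
  "hex_type2_3 = {(P, A, B, C, D, Q). maximal_tuple [P, A, B, C, D, Q] \<and>
     generic P A B Q \<and> \<not> generic P B C Q \<and> \<not> generic P C D Q}"

fun hex_lengths :: "hexagon \<Rightarrow> (real \<times> real) \<times> (real \<times> real) \<times> (real \<times> real)" where
  "hex_lengths (P, A, B, C, D, Q) = (weyl_length P A B Q, weyl_length P B C Q, weyl_length P C D Q)"

text \<open>An element of \<^const>\<open>PSp4\<close> is a coset \<open>{g, - g}\<close>, whose two members map a subspace to the
  same image; the union below is that common image.\<close>

definition psp_image :: "(real^4^4) set \<Rightarrow> (real^4) set \<Rightarrow> (real^4) set" where
  "psp_image \<Gamma> l = (\<Union>g\<in>\<Gamma>. (*v) g ` l)"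

fun hex_act :: "(real^4^4) set \<Rightarrow> hexagon \<Rightarrow> hexagon" where
  "hex_act \<Gamma> (P, A, B, C, D, Q) =
     (psp_image \<Gamma> P, psp_image \<Gamma> A, psp_image \<Gamma> B, psp_image \<Gamma> C, psp_image \<Gamma> D, psp_image \<Gamma> Q)"

text \<open>The bijection on the set of orbits is the map induced by \<open>hex_lengths\<close>; the first conjunct
  asserts that \<open>hex_lengths\<close> descends to orbits.\<close>

definition lengths_parametrize ::
    "hexagon set \<Rightarrow> ((real \<times> real) \<times> (real \<times> real) \<times> (real \<times> real)) set \<Rightarrow> bool" where
  "lengths_parametrize H T \<longleftrightarrow>
     (\<exists>F. (\<forall>h\<in>H. F (orbit PSp4 hex_act h) = hex_lengths h) \<and>
          bij_betw F (orbits PSp4 H hex_act) T)"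

end

theory Submission
  imports Defs "HOL-Library.Quadratic_Discriminant"
begin

text \<open>A symplectic map moves \<open>P\<close>, \<open>A\<close>, \<open>Q\<close> to \<open>\<infinity>\<close>, \<open>0\<close>, \<open>Id\<close>. The other Lagrangians then are
  \<open>Id - M\<close> with \<open>M\<close> symmetric and decreasing from \<open>Id\<close> to \<open>0\<close> along the tuple, and the cross-ratio of
  \<open>(P, X, Y, Q)\<close> has as eigenvalues the generalized eigenvalues of the two symmetric matrices
  of \<open>X\<close> and \<open>Y\<close>. If they coincide, the matrices are proportional. So with at most one generic
  quadruple, one rotation, which still fixes \<open>P\<close>, \<open>A\<close>, \<open>Q\<close>, diagonalizes all the matrices, and the
  diagonal entries are determined by the lengths. Conversely, decreasing diagonal matrices form
  a maximal tuple, as the problem splits into two copies of \<open>SL(2, \<real>)\<close>.\<close>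

section \<open>Coordinates in dimension four\<close>

lemma vector_4 [simp]:
  "(vector [a, b, c, d] :: 'a::zero^4) $ 1 = a"
  "(vector [a, b, c, d] :: 'a::zero^4) $ 2 = b"
  "(vector [a, b, c, d] :: 'a::zero^4) $ 3 = c"
  "(vector [a, b, c, d] :: 'a::zero^4) $ 4 = d"
  unfolding vector_def by simp_all

lemma vec4_eq_iff: "(v :: 'a^4) = w \<longleftrightarrow> v $ 1 = w $ 1 \<and> v $ 2 = w $ 2 \<and> v $ 3 = w $ 3 \<and> v $ 4 = w $ 4"
  by (simp add: vec_eq_iff forall_4)

lemma matrix_vector_mult_4:
  "(g *v v) $ i = g $ i $ 1 * v $ 1 + g $ i $ 2 * v $ 2 + g $ i $ 3 * v $ 3 + g $ i $ 4 * (v :: real^4) $ 4"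
  by (simp add: matrix_vector_mult_def sum_4)

lemma matrix_matrix_mult_4:
  "((g :: real^4^4) ** h) $ i $ j =
     g $ i $ 1 * h $ 1 $ j + g $ i $ 2 * h $ 2 $ j + g $ i $ 3 * h $ 3 $ j + g $ i $ 4 * h $ 4 $ j"
  by (simp add: matrix_matrix_mult_def sum_4)

section \<open>The symplectic group\<close>

lemma Sp4_iff: "g \<in> carrier Sp4 \<longleftrightarrow> transpose g ** symp_mat ** g = symp_mat"
  by (simp add: Sp4_def)

lemma Sp4_mult:
  assumes "g \<in> carrier Sp4" "h \<in> carrier Sp4"
  shows "g ** h \<in> carrier Sp4"
proof -
  have "transpose (g ** h) ** symp_mat ** (g ** h) = transpose h ** (transpose g ** symp_mat ** g) ** h"
    by (simp add: matrix_transpose_mul matrix_mul_assoc)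
  with assms show ?thesis
    by (simp add: Sp4_iff)
qed

lemma Sp4_one: "mat 1 \<in> carrier Sp4"
  by (simp add: Sp4_iff)

lemma symp_mat_square: "symp_mat ** symp_mat = - mat 1"
  by (simp add: vec4_eq_iff matrix_matrix_mult_4 symp_mat_def mat_def)

text \<open>Write J for \<open>symp_mat\<close>. As J squared is -Id, multiplying the defining
  equation of the group by -J on the left exhibits a left inverse; for square matrices it is
  two-sided.\<close>

lemma Sp4_inverse:
  assumes "g \<in> carrier Sp4"
  obtains h where "h \<in> carrier Sp4" "g ** h = mat 1" "h ** g = mat 1"
proof -
  define h where "h = - (symp_mat ** transpose g ** symp_mat)"
  have neg: "(- a) ** b = - (a ** b)" for a b :: "real^4^4"
    by (simp add: vec4_eq_iff matrix_matrix_mult_4)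
  have hg: "h ** g = mat 1"
  proof -
    have "h ** g = - (symp_mat ** (transpose g ** symp_mat ** g))"
      by (simp add: h_def neg matrix_mul_assoc)
    with assms show ?thesis
      by (simp add: Sp4_iff symp_mat_square)
  qed
  then have gh: "g ** h = mat 1"
    by (simp add: matrix_left_right_inverse)
  have "h \<in> carrier Sp4"
  proof -
    have "transpose h ** symp_mat ** h = transpose h ** (transpose g ** symp_mat ** g) ** h"
      using assms by (simp add: Sp4_iff)
    also have "\<dots> = transpose (g ** h) ** symp_mat ** (g ** h)"
      by (simp add: matrix_transpose_mul matrix_mul_assoc)
    finally show ?thesis
      by (simp add: Sp4_iff gh)
  qed
  with that gh hg show thesis by blast
qed

section \<open>Invariance of the form and of Lagrangians\<close>

lemma symp_form_coords: "symp_form x y = x $ 1 * y $ 3 + x $ 2 * y $ 4 - x $ 3 * y $ 1 - x $ 4 * y $ 2"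
  by (simp add: symp_form_def inner_vec_def sum_4 matrix_vector_mult_4 symp_mat_def)

lemma symp_form_Sp4:
  assumes "g \<in> carrier Sp4"
  shows "symp_form (g *v x) (g *v y) = symp_form x y"
proof -
  have "symp_form (g *v x) (g *v y) = (x v* transpose g) \<bullet> (symp_mat *v (g *v y))"
    by (simp add: symp_form_def)
  also have "\<dots> = x \<bullet> ((transpose g ** symp_mat ** g) *v y)"
    by (simp only: dot_lmul_matrix matrix_vector_mul_assoc matrix_mul_assoc)
  finally show ?thesis
    using assms by (simp add: Sp4_iff symp_form_def)
qed

lemma image_mult: "(*v) (g ** h) ` S = (*v) g ` (*v) h ` S"
  for g h :: "real^4^4"
  by (simp add: image_image matrix_vector_mul_assoc)

lemma image_one: "(*v) (mat 1 :: real^4^4) ` S = S"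
  by simp

lemma Sp4_inj:
  assumes "g \<in> carrier Sp4"
  shows "inj ((*v) g)"
proof -
  obtain h where "h ** g = mat 1"
    using Sp4_inverse[OF assms] by blast
  then have "h *v (g *v v) = v" for v
    by (simp add: matrix_vector_mul_assoc)
  then show ?thesis
    by (rule inj_on_inverseI)
qed

lemma mem_image_Sp4: "g \<in> carrier Sp4 \<Longrightarrow> g *v v \<in> (*v) g ` S \<longleftrightarrow> v \<in> S"
  by (rule inj_image_mem_iff[OF Sp4_inj])

lemma lagrangian_image:
  assumes "g \<in> carrier Sp4" "lagrangian l"
  shows "lagrangian ((*v) g ` l)"
proof -
  have "dim ((*v) g ` l) = dim l"
    using Sp4_inj[OF assms(1)] by (intro dim_image_eq) (auto intro: inj_on_subset)
  then show ?thesis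
    using assms by (auto simp: lagrangian_def symp_form_Sp4 intro: linear_subspace_image)
qed

lemma transverse_image:
  assumes "g \<in> carrier Sp4" "transverse l l'"
  shows "transverse ((*v) g ` l) ((*v) g ` l')"
proof -
  have "(*v) g ` l \<inter> (*v) g ` l' = (*v) g ` (l \<inter> l')"
    using image_Int[OF Sp4_inj[OF assms(1)]] by blast
  then show ?thesis
    using assms(2) by (simp add: transverse_def)
qed

section \<open>An affine chart on the Lagrangians\<close>

text \<open>\<open>chart x y z\<close> is the Lagrangian of the symmetric matrix \<open>Id - M\<close>, where \<open>M\<close> has rows
  \<open>(x, y)\<close> and \<open>(y, z)\<close>. In this chart the base triple of Lagrangians \<open>(\<infinity>, 0, Id)\<close> is
  given by \<open>\<infinity>\<close>, \<open>M = Id\<close> and \<open>M = 0\<close>.\<close>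

definition chart :: "real \<Rightarrow> real \<Rightarrow> real \<Rightarrow> (real^4) set" where
  "chart x y z = {v. v $ 1 = v $ 3 - (x * v $ 3 + y * v $ 4) \<and> v $ 2 = v $ 4 - (y * v $ 3 + z * v $ 4)}"

lemma span_pair: "span {u, w} = {k *\<^sub>R u + k' *\<^sub>R w | k k'. True}"
  by (auto simp: span_insert span_singleton algebra_simps)

lemma lag_infinity_eq: "lag_infinity = {v. v $ 3 = 0 \<and> v $ 4 = 0}"
proof -
  have "v = (v $ 1) *\<^sub>R axis 1 1 + (v $ 2) *\<^sub>R axis 2 1" if "v $ 3 = 0" "v $ 4 = 0" for v :: "real^4"
    using that by (simp add: vec4_eq_iff axis_def)
  then show ?thesis
    unfolding lag_infinity_def span_pair by (auto simp: axis_def)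
qed

lemma chart_eq_span: "chart x y z = span {vector [1 - x, - y, 1, 0], vector [- y, 1 - z, 0, 1]}"
  (is "_ = span {?u, ?w}")
proof -
  have "v = (v $ 3) *\<^sub>R ?u + (v $ 4) *\<^sub>R ?w" if "v \<in> chart x y z" for v
    using that by (simp add: vec4_eq_iff chart_def algebra_simps)
  moreover have "k *\<^sub>R ?u + k' *\<^sub>R ?w \<in> chart x y z" for k k'
    by (simp add: chart_def algebra_simps)
  ultimately show ?thesis
    unfolding span_pair by blast
qed

text \<open>Both finite members of the base triple are scalar matrices, so this case covers them.
  The entries \<open>1 - a\<close> appear because the chart records Id - X.\<close>

lemma lag_of_scalar: "lag_of (mat a) = chart (1 - a) 0 (1 - a)"
proof -
  let ?M = "vector [row 1 (mat a), row 2 (mat a), row 1 (mat 1), row 2 (mat 1)] :: real^2^4"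
  have "columns ?M = {column 1 ?M, column 2 ?M}"
    by (auto simp: columns_def image_Collect[symmetric] UNIV_2)
  moreover have "column 1 ?M = vector [a, 0, 1, 0]" "column 2 ?M = vector [0, a, 0, 1]"
    by (simp_all add: vec4_eq_iff column_def row_def mat_def)
  ultimately show ?thesis
    by (simp add: lag_of_def chart_eq_span)
qed

lemma lag_of_zero: "lag_of 0 = chart 1 0 1"
  using lag_of_scalar[of 0] by simp

lemma lag_of_one: "lag_of (mat 1) = chart 0 0 0"
  using lag_of_scalar[of 1] by simp

lemma lagrangian_infinity: "lagrangian lag_infinity"
proof -
  have "independent {axis 1 1, axis 2 1 :: real^4}"
    by (rule independent_mono[OF independent_Basis]) (auto simp: Basis_vec_def)
  moreover have "axis 1 1 \<noteq> (axis 2 1 :: real^4)"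
    by (simp add: axis_eq_axis)
  ultimately have "dim lag_infinity = 2"
    unfolding lag_infinity_def by (simp add: dim_eq_card_independent)
  then show ?thesis
    by (auto simp: lagrangian_def symp_form_coords lag_infinity_eq subspace_def)
qed

text \<open>Independence is visible in the last two coordinates of the generators. Isotropy
  expresses the symmetry of the matrix, that is, the shared entry \<open>y\<close>.\<close>

lemma lagrangian_chart: "lagrangian (chart x y z)"
proof -
  let ?u = "vector [1 - x, - y, 1, 0] :: real^4" and ?w = "vector [- y, 1 - z, 0, 1] :: real^4"
  have "?u \<notin> span {?w}" "?w \<noteq> 0" "?u \<noteq> ?w"
    by (auto simp: span_singleton vec4_eq_iff)
  then have "independent {?u, ?w}"
    by (simp add: independent_insert)
  with \<open>?u \<noteq> ?w\<close> have "dim (chart x y z) = 2"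
    by (simp add: chart_eq_span dim_eq_card_independent)
  moreover have "subspace (chart x y z)"
    by (simp add: chart_eq_span)
  moreover have "symp_form v w = 0" if "v \<in> chart x y z" "w \<in> chart x y z" for v w
  proof -
    have v: "v $ 1 = v $ 3 - (x * v $ 3 + y * v $ 4)" "v $ 2 = v $ 4 - (y * v $ 3 + z * v $ 4)"
      and w: "w $ 1 = w $ 3 - (x * w $ 3 + y * w $ 4)" "w $ 2 = w $ 4 - (y * w $ 3 + z * w $ 4)"
      using that by (simp_all add: chart_def)
    show ?thesis
      unfolding symp_form_coords v w by (simp add: algebra_simps)
  qed
  ultimately show ?thesis
    by (simp add: lagrangian_def)
qed

text \<open>Two planes with trivial intersection span a space of dimension 2 + 2 = 4.\<close>

lemma transverse_sum:
  assumes "lagrangian l" "lagrangian l'" "transverse l l'"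
  obtains u where "u \<in> l" "v - u \<in> l'"
proof -
  have sub: "subspace l" "subspace l'"
    using assms by (auto simp: lagrangian_def)
  have "dim {x + y | x y. x \<in> l \<and> y \<in> l'} = DIM(real^4)"
    using dim_sums_Int[OF sub] assms by (simp add: lagrangian_def transverse_def)
  then have "span {x + y | x y. x \<in> l \<and> y \<in> l'} = UNIV"
    by (simp only: dim_eq_full)
  then have "{x + y | x y. x \<in> l \<and> y \<in> l'} = UNIV"
    using span_eq_iff[THEN iffD2, OF subspace_sums[OF sub]] by simp
  then obtain x y where "v = x + y" "x \<in> l" "y \<in> l'"
    by blast
  with that[of x] show thesis by simp
qed

lemma transverse_infinity_chart: "transverse lag_infinity (chart x y z)"
  by (auto simp: transverse_def lag_infinity_eq chart_def vec4_eq_iff)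

text \<open>The third and fourth basis vectors have lifts in \<open>l\<close> modulo
  \<open>lag_infinity\<close>. These lifts generate a chart plane, and isotropy of \<open>l\<close>
  is what makes its matrix symmetric (\<open>uw\<close>).\<close>

lemma transverse_to_infinity:
  assumes "lagrangian l" "transverse lag_infinity l"
  obtains x y z where "l = chart x y z"
proof -
  obtain u where u: "u \<in> lag_infinity" "axis 3 1 - u \<in> l"
    using transverse_sum[OF lagrangian_infinity assms] by blast
  obtain w where w: "w \<in> lag_infinity" "axis 4 1 - w \<in> l"
    using transverse_sum[OF lagrangian_infinity assms] by blast
  let ?u = "axis 3 1 - u" and ?w = "axis 4 1 - w"
  have "symp_form ?u ?w = 0"
    using assms u w by (simp add: lagrangian_def)
  then have uw: "u $ 2 = w $ 1"
    using u w by (simp add: symp_form_coords lag_infinity_eq axis_def)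
  define x y z where "x = 1 + u $ 1" "y = w $ 1" "z = 1 + w $ 2"
  have gens: "?u = vector [1 - x, - y, 1, 0]" "?w = vector [- y, 1 - z, 0, 1]"
    using u w uw by (simp_all add: vec4_eq_iff x_y_z_def lag_infinity_eq axis_def)
  have sub: "subspace l"
    using assms by (simp add: lagrangian_def)
  have "chart x y z \<subseteq> l"
    unfolding chart_eq_span gens[symmetric] using u w sub by (intro span_minimal) auto
  moreover have "subspace (chart x y z)" "dim l \<le> dim (chart x y z)"
    using assms lagrangian_chart[of x y z] by (simp_all add: lagrangian_def)
  ultimately have "chart x y z = l"
    using sub by (intro subspace_dim_equal)
  then show thesis by (rule that[OF sym])
qed

section \<open>Maximal triples\<close>

text \<open>The Lagrangian and transversality conditions hold for the base triple and are invariant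
  under the group, so only the orbit condition remains.\<close>

lemma maximal_triple_iff:
  "maximal_triple l1 l2 l3 \<longleftrightarrow>
     (\<exists>g\<in>carrier Sp4. l1 = (*v) g ` lag_infinity \<and> l2 = (*v) g ` chart 1 0 1 \<and> l3 = (*v) g ` chart 0 0 0)"
proof -
  have "transverse (chart 1 0 1) (chart 0 0 0)"
    by (auto simp: transverse_def chart_def vec4_eq_iff)
  then have "lagrangian l1 \<and> lagrangian l2 \<and> lagrangian l3 \<and>
      transverse l1 l2 \<and> transverse l2 l3 \<and> transverse l1 l3"
    if "g \<in> carrier Sp4" "l1 = (*v) g ` lag_infinity" "l2 = (*v) g ` chart 1 0 1"
      "l3 = (*v) g ` chart 0 0 0" for g
    unfolding that(2-4)
    by (intro conjI lagrangian_image transverse_image lagrangian_infinity lagrangian_chart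
        transverse_infinity_chart that(1))
  then show ?thesis
    unfolding maximal_triple_def lag_of_zero lag_of_one by blast
qed

lemma maximal_triple_image:
  assumes "g \<in> carrier Sp4" "maximal_triple l1 l2 l3"
  shows "maximal_triple ((*v) g ` l1) ((*v) g ` l2) ((*v) g ` l3)"
proof -
  obtain h where h: "h \<in> carrier Sp4" "l1 = (*v) h ` lag_infinity" "l2 = (*v) h ` chart 1 0 1"
    "l3 = (*v) h ` chart 0 0 0"
    using assms(2) unfolding maximal_triple_iff by blast
  show ?thesis
    unfolding maximal_triple_iff h(2-4) image_mult[symmetric]
    using Sp4_mult[OF assms(1) h(1)] by blast
qed

text \<open>The sign of the Maslov form, an invariant which detects maximality.\<close>

lemma maximal_triple_symp_form_neg:
  assumes "maximal_triple l1 l2 l3" "u \<in> l1" "w \<in> l3" "u + w \<in> l2" "u + w \<noteq> 0"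
  shows "symp_form u w < 0"
proof -
  obtain g where g: "g \<in> carrier Sp4" "l1 = (*v) g ` lag_infinity" "l2 = (*v) g ` chart 1 0 1"
    "l3 = (*v) g ` chart 0 0 0"
    using assms(1) unfolding maximal_triple_iff by blast
  obtain u' w' where u': "u = g *v u'" "u' \<in> lag_infinity" and w': "w = g *v w'" "w' \<in> chart 0 0 0"
    using assms(2,3) g by blast
  have "g *v (u' + w') \<in> (*v) g ` chart 1 0 1"
    using assms(4) u' w' g by (simp add: matrix_vector_right_distrib)
  then have "u' + w' \<in> chart 1 0 1"
    using g(1) mem_image_Sp4 by blast
  moreover have "u' + w' \<noteq> 0"
    using assms(5) u' w' by (metis matrix_vector_mult_0_right matrix_vector_right_distrib)
  \<comment> \<open>Here w' = (p, q, p, q), and the first two coordinates of u' + w' vanish, so u' =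
    (-p, -q, 0, 0).\<close>
  ultimately have "symp_form u' w' = - ((w' $ 3)\<^sup>2 + (w' $ 4)\<^sup>2)" "w' $ 3 \<noteq> 0 \<or> w' $ 4 \<noteq> 0"
    using u'(2) w'(2)
    by (auto simp: symp_form_coords chart_def lag_infinity_eq vec4_eq_iff power2_eq_square
        eq_neg_iff_add_eq_0[symmetric])
  moreover from this have "(w' $ 3)\<^sup>2 + (w' $ 4)\<^sup>2 > 0"
    by (simp only: sum_power2_gt_zero_iff)
  ultimately have "symp_form u' w' < 0"
    by simp
  then show ?thesis
    using g(1) u' w' by (simp add: symp_form_Sp4)
qed

text \<open>The sign test is applied to the vector of the middle plane with lower half (p, q), split
  along the outer two planes. The form then takes the difference of the two quadratic forms as its
  value.\<close>

lemma maximal_triple_chart_less: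
  assumes "maximal_triple lag_infinity (chart x1 x2 x3) (chart y1 y2 y3)" "p \<noteq> 0 \<or> q \<noteq> 0"
  shows "y1 * p\<^sup>2 + 2 * y2 * p * q + y3 * q\<^sup>2 < x1 * p\<^sup>2 + 2 * x2 * p * q + x3 * q\<^sup>2"
proof -
  let ?w = "vector [p - (y1 * p + y2 * q), q - (y2 * p + y3 * q), p, q] :: real^4"
  let ?u = "vector [(y1 * p + y2 * q) - (x1 * p + x2 * q), (y2 * p + y3 * q) - (x2 * p + x3 * q), 0, 0] :: real^4"
  have "symp_form ?u ?w < 0"
    by (rule maximal_triple_symp_form_neg[OF assms(1)])
       (use assms(2) in \<open>auto simp: lag_infinity_eq chart_def vec4_eq_iff\<close>)
  then show ?thesis
    by (simp add: symp_form_coords algebra_simps power2_eq_square)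
qed

text \<open>Equal dimensions. Images of Lagrangians are computed below by proving a single
  inclusion.\<close>

lemma lagrangian_subset_eq:
  assumes "lagrangian l" "lagrangian l'" "l \<subseteq> l'"
  shows "l = l'"
  using assms by (intro subspace_dim_equal) (auto simp: lagrangian_def)

section \<open>Eigenvalues of the cross-ratio\<close>

lemma proj_along_eqI:
  assumes "lagrangian l" "lagrangian l'" "transverse l l'" "u \<in> l" "v - u \<in> l'"
  shows "proj_along l l' v = u"
  unfolding proj_along_def
proof (rule the_equality)
  fix w assume w: "w \<in> l \<and> v - w \<in> l'"
  have "w - u \<in> l"
    using assms w by (simp add: lagrangian_def subspace_diff)
  moreover have "(v - u) - (v - w) \<in> l'"
    by (rule subspace_diff) (use assms w in \<open>simp_all add: lagrangian_def\<close>)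
  ultimately have "w - u \<in> l \<inter> l'"
    by simp
  then have "w - u \<in> {0}"
    using assms(3) by (simp only: transverse_def)
  then show "w = u"
    by simp
qed (use assms in simp)

text \<open>Eliminates the projections: \<open>u\<close> is the projection of \<open>v\<close> to
  \<open>Q\<close> along \<open>Y\<close>, and \<mu> v has to be the projection of \<open>u\<close>
  to \<open>P\<close> along \<open>X\<close>. Only memberships remain, which linear bijections
  respect.\<close>

lemma mem_cr_eigenvalues_iff:
  assumes lag: "lagrangian P" "lagrangian X" "lagrangian Y" "lagrangian Q"
    and tr: "transverse P X" "transverse Q Y"
  shows "\<mu> \<in> cr_eigenvalues P X Y Q \<longleftrightarrow>
    (\<exists>v\<in>P. v \<noteq> 0 \<and> (\<exists>u\<in>Q. v - u \<in> Y \<and> u - \<mu> *\<^sub>R v \<in> X))"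
proof -
  have "cross_ratio P X Y Q v = \<mu> *\<^sub>R v \<longleftrightarrow> (\<exists>u\<in>Q. v - u \<in> Y \<and> u - \<mu> *\<^sub>R v \<in> X)"
    if v: "v \<in> P" for v
  proof -
    obtain u where u: "u \<in> Q" "v - u \<in> Y"
      using transverse_sum[OF lag(4,3) tr(2)] by blast
    obtain w where w: "w \<in> P" "u - w \<in> X"
      using transverse_sum[OF lag(1,2) tr(1)] by blast
    have proj: "proj_along Q Y v = u'" if "u' \<in> Q" "v - u' \<in> Y" for u'
      using proj_along_eqI[OF lag(4,3) tr(2) that] .
    have proj': "proj_along P X u = w'" if "w' \<in> P" "u - w' \<in> X" for w'
      using proj_along_eqI[OF lag(1,2) tr(1) that] .
    have "\<mu> *\<^sub>R v \<in> P"
      using lag(1) v by (simp add: lagrangian_def subspace_scale)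
    moreover have "cross_ratio P X Y Q v = w"
      using v proj[OF u] proj'[OF w] by (simp add: cross_ratio_def)
    ultimately show ?thesis
      using u w proj[OF u] proj proj'[of "\<mu> *\<^sub>R v"] proj'[OF w] by auto
  qed
  then show ?thesis
    by (auto simp: cr_eigenvalues_def)
qed

lemma cr_eigenvalues_image:
  assumes g: "g \<in> carrier Sp4"
    and lag: "lagrangian P" "lagrangian X" "lagrangian Y" "lagrangian Q"
    and tr: "transverse P X" "transverse Q Y"
  shows "cr_eigenvalues ((*v) g ` P) ((*v) g ` X) ((*v) g ` Y) ((*v) g ` Q) = cr_eigenvalues P X Y Q"
proof -
  have "g *v v - g *v u \<in> (*v) g ` S \<longleftrightarrow> v - u \<in> S" for u v and S :: "(real^4) set"
    using mem_image_Sp4[OF g] by (simp add: matrix_vector_mult_diff_distrib[symmetric])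
  moreover have "g *v u - \<mu> *\<^sub>R (g *v v) \<in> (*v) g ` S \<longleftrightarrow> u - \<mu> *\<^sub>R v \<in> S"
    for u v \<mu> and S :: "(real^4) set"
    using mem_image_Sp4[OF g, of "u - \<mu> *\<^sub>R v"]
    by (simp add: matrix_vector_mult_diff_distrib matrix_vector_mult_scaleR)
  moreover have "g *v v = 0 \<longleftrightarrow> v = 0" for v
    using inj_eq[OF Sp4_inj[OF g], of v 0] by simp
  ultimately show ?thesis
    using assms by (simp add: set_eq_iff mem_cr_eigenvalues_iff lagrangian_image transverse_image bex_simps(7))
qed

text \<open>The generalized eigenvalues \<open>\<mu>\<close> of two symmetric matrices, \<open>X v = \<mu> Y v\<close>.\<close>

definition pencil_eigenvalues :: "real \<Rightarrow> real \<Rightarrow> real \<Rightarrow> real \<Rightarrow> real \<Rightarrow> real \<Rightarrow> real set" where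
  "pencil_eigenvalues x1 x2 x3 y1 y2 y3 =
     {\<mu>. \<exists>p q. (p \<noteq> 0 \<or> q \<noteq> 0) \<and> x1 * p + x2 * q = \<mu> * (y1 * p + y2 * q) \<and>
                x2 * p + x3 * q = \<mu> * (y2 * p + y3 * q)}"

text \<open>If the determinant vanishes, (b, -a) lies in the kernel; it is nonzero unless the first
  row is zero, and then (1, 0) works.\<close>

lemma sym_matrix_kernel:
  fixes a b c :: real
  shows "(\<exists>p q. (p \<noteq> 0 \<or> q \<noteq> 0) \<and> a * p + b * q = 0 \<and> b * p + c * q = 0) \<longleftrightarrow> a * c - b\<^sup>2 = 0"
proof
  assume "\<exists>p q. (p \<noteq> 0 \<or> q \<noteq> 0) \<and> a * p + b * q = 0 \<and> b * p + c * q = 0"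
  then obtain p q where *: "p \<noteq> 0 \<or> q \<noteq> 0" "a * p + b * q = 0" "b * p + c * q = 0"
    by blast
  have "(a * c - b\<^sup>2) * p = 0" "(a * c - b\<^sup>2) * q = 0"
    using *(2,3) by algebra+
  with *(1) show "a * c - b\<^sup>2 = 0"
    by auto
next
  assume det: "a * c - b\<^sup>2 = 0"
  show "\<exists>p q. (p \<noteq> 0 \<or> q \<noteq> 0) \<and> a * p + b * q = 0 \<and> b * p + c * q = 0"
  proof (cases "a = 0 \<and> b = 0")
    case True
    then show ?thesis
      by (intro exI[of _ 1] exI[of _ 0]) simp
  next
    case False
    with det show ?thesis
      by (intro exI[of _ b] exI[of _ "- a"]) (auto simp: power2_eq_square algebra_simps)
  qed
qed

lemma pencil_eigenvalues_eq:
  "pencil_eigenvalues x1 x2 x3 y1 y2 y3 = {\<mu>. (x1 - \<mu> * y1) * (x3 - \<mu> * y3) - (x2 - \<mu> * y2)\<^sup>2 = 0}"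
proof -
  have "x * p + y * q = \<mu> * (x' * p + y' * q) \<longleftrightarrow> (x - \<mu> * x') * p + (y - \<mu> * y') * q = 0"
    for x y x' y' p q \<mu> :: real
    by (auto simp: algebra_simps)
  then show ?thesis
    unfolding pencil_eigenvalues_def sym_matrix_kernel[symmetric] by presburger
qed

lemma pencil_eigenvalues_diagonal:
  assumes "y \<noteq> 0" "y' \<noteq> 0"
  shows "pencil_eigenvalues x 0 x' y 0 y' = {x / y, x' / y'}"
  using assms by (auto simp: pencil_eigenvalues_eq eq_divide_eq)

text \<open>The discriminant of \<open>det (X - \<mu> Y)\<close> is a sum of two squares which vanish
  simultaneously only if \<open>X\<close> and \<open>Y\<close> are proportional.\<close>

lemma card_pencil_eigenvalues:
  assumes y: "y1 > 0" "y1 * y3 - y2\<^sup>2 > 0"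
    and card: "card (pencil_eigenvalues x1 x2 x3 y1 y2 y3) \<noteq> 2"
  obtains k where "x1 = k * y1" "x2 = k * y2" "x3 = k * y3"
proof -
  define \<alpha> \<beta> \<gamma> where "\<alpha> = y1 * y3 - y2\<^sup>2" "\<beta> = 2 * x2 * y2 - x1 * y3 - x3 * y1" "\<gamma> = x1 * x3 - x2\<^sup>2"
  define a b where "a = x1 * y2 - x2 * y1" "b = x1 * y3 - x3 * y1"
  have "pencil_eigenvalues x1 x2 x3 y1 y2 y3 = {\<mu>. \<alpha> * \<mu>\<^sup>2 + \<beta> * \<mu> + \<gamma> = 0}"
    by (simp add: pencil_eigenvalues_eq \<alpha>_\<beta>_\<gamma>_def algebra_simps power2_eq_square)
  moreover have "\<alpha> \<noteq> 0"
    using y by (simp add: \<alpha>_\<beta>_\<gamma>_def)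
  ultimately have "\<not> discrim \<alpha> \<beta> \<gamma> > 0"
  proof (intro notI)
    assume *: "pencil_eigenvalues x1 x2 x3 y1 y2 y3 = {\<mu>. \<alpha> * \<mu>\<^sup>2 + \<beta> * \<mu> + \<gamma> = 0}"
      "\<alpha> \<noteq> 0" "discrim \<alpha> \<beta> \<gamma> > 0"
    let ?r = "\<lambda>\<epsilon>. (- \<beta> + \<epsilon> * sqrt (discrim \<alpha> \<beta> \<gamma>)) / (2 * \<alpha>)"
    have "pencil_eigenvalues x1 x2 x3 y1 y2 y3 = {?r 1, ?r (-1)}"
      using * by (auto simp: discriminant_iff)
    moreover have "?r 1 \<noteq> ?r (-1)"
      using * by (simp add: field_simps)
    ultimately show False
      using card by simp
  qed
  \<comment> \<open>\<open>a\<close> and \<open>b\<close> are 2 by 2 minors of the array with rows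
    \<open>x1 x2 x3\<close> and \<open>y1 y2 y3\<close>. As \<open>y1\<close> is nonzero, their
    vanishing makes the rows proportional.\<close>
  moreover have "y1\<^sup>2 * discrim \<alpha> \<beta> \<gamma> = (b * y1 - 2 * a * y2)\<^sup>2 + 4 * a\<^sup>2 * \<alpha>"
    unfolding discrim_def \<alpha>_\<beta>_\<gamma>_def a_b_def by algebra
  ultimately have "(b * y1 - 2 * a * y2)\<^sup>2 + 4 * a\<^sup>2 * \<alpha> \<le> 0"
    by (metis mult_nonneg_nonpos not_less zero_le_power2)
  moreover have "4 * a\<^sup>2 * \<alpha> \<ge> 0"
    using y by (simp add: \<alpha>_\<beta>_\<gamma>_def)
  ultimately have "4 * a\<^sup>2 * \<alpha> = 0" "(b * y1 - 2 * a * y2)\<^sup>2 = 0"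
    using zero_le_power2[of "b * y1 - 2 * a * y2"] by linarith+
  then have "a = 0" "b = 0"
    using y \<open>\<alpha> \<noteq> 0\<close> by auto
  with y that[of "x1 / y1"] show thesis
    by (simp add: a_b_def field_simps)
qed

text \<open>Vectors of \<open>chart 0 0 0\<close> have equal upper and lower halves, so the lower
  half of a common vector lies in the kernel of the matrix.\<close>

lemma transverse_zero_chart:
  assumes "y1 * y3 - y2\<^sup>2 \<noteq> 0"
  shows "transverse (chart 0 0 0) (chart y1 y2 y3)"
proof -
  have ker: "p = 0 \<and> q = 0" if "y1 * p + y2 * q = 0" "y2 * p + y3 * q = 0" for p q
    using assms that sym_matrix_kernel[of y1 y2 y3] by blast
  have "v = 0" if "v \<in> chart 0 0 0" "v \<in> chart y1 y2 y3" for v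
    using that ker[of "v $ 3" "v $ 4"] by (simp add: chart_def vec4_eq_iff)
  then show ?thesis
    by (auto simp: transverse_def chart_def)
qed

text \<open>For u = (p, q, p, q) in \<open>chart 0 0 0\<close>, the condition on v - u forces v =
  (Y(p, q), 0), and the one on u - \<mu> v then reads X(p, q) = \<mu> Y(p, q). Invertibility of Y
  makes v nonzero exactly when (p, q) is.\<close>

lemma cr_eigenvalues_chart:
  assumes det: "y1 * y3 - y2\<^sup>2 \<noteq> 0"
  shows "cr_eigenvalues lag_infinity (chart x1 x2 x3) (chart y1 y2 y3) (chart 0 0 0) =
    pencil_eigenvalues x1 x2 x3 y1 y2 y3"
proof (rule Set.set_eqI)
  fix \<mu>
  have ker: "p = 0 \<and> q = 0" if "y1 * p + y2 * q = 0" "y2 * p + y3 * q = 0" for p q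
    using det that sym_matrix_kernel[of y1 y2 y3] by blast
  have "\<mu> \<in> cr_eigenvalues lag_infinity (chart x1 x2 x3) (chart y1 y2 y3) (chart 0 0 0) \<longleftrightarrow>
    (\<exists>v\<in>lag_infinity. v \<noteq> 0 \<and>
       (\<exists>u\<in>chart 0 0 0. v - u \<in> chart y1 y2 y3 \<and> u - \<mu> *\<^sub>R v \<in> chart x1 x2 x3))"
    by (intro mem_cr_eigenvalues_iff lagrangian_infinity lagrangian_chart transverse_infinity_chart
        transverse_zero_chart[OF det])
  also have "\<dots> \<longleftrightarrow> \<mu> \<in> pencil_eigenvalues x1 x2 x3 y1 y2 y3"
  proof
    assume "\<exists>v\<in>lag_infinity. v \<noteq> 0 \<and>
       (\<exists>u\<in>chart 0 0 0. v - u \<in> chart y1 y2 y3 \<and> u - \<mu> *\<^sub>R v \<in> chart x1 x2 x3)"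
    then obtain v u where *: "v \<in> lag_infinity" "v \<noteq> 0" "u \<in> chart 0 0 0"
      "v - u \<in> chart y1 y2 y3" "u - \<mu> *\<^sub>R v \<in> chart x1 x2 x3"
      by blast
    have v: "v $ 1 = y1 * u $ 3 + y2 * u $ 4" "v $ 2 = y2 * u $ 3 + y3 * u $ 4" "v $ 3 = 0" "v $ 4 = 0"
      using *(1,3,4) by (auto simp: lag_infinity_eq chart_def)
    have "u $ 3 \<noteq> 0 \<or> u $ 4 \<noteq> 0"
      using v *(2) by (auto simp: vec4_eq_iff)
    moreover have "\<mu> * v $ 1 = x1 * u $ 3 + x2 * u $ 4" "\<mu> * v $ 2 = x2 * u $ 3 + x3 * u $ 4"
      using *(3,5) v(3,4) by (auto simp: chart_def)
    ultimately show "\<mu> \<in> pencil_eigenvalues x1 x2 x3 y1 y2 y3"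
      unfolding pencil_eigenvalues_def v mem_Collect_eq by metis
  next
    assume "\<mu> \<in> pencil_eigenvalues x1 x2 x3 y1 y2 y3"
    then obtain p q where pq: "p \<noteq> 0 \<or> q \<noteq> 0" "x1 * p + x2 * q = \<mu> * (y1 * p + y2 * q)"
      "x2 * p + x3 * q = \<mu> * (y2 * p + y3 * q)"
      unfolding pencil_eigenvalues_def by blast
    let ?v = "vector [y1 * p + y2 * q, y2 * p + y3 * q, 0, 0] :: real^4"
      and ?u = "vector [p, q, p, q] :: real^4"
    have "?v \<noteq> 0"
      using pq(1) ker[of p q] by (auto simp: vec4_eq_iff)
    moreover have "?v \<in> lag_infinity" "?u \<in> chart 0 0 0" "?v - ?u \<in> chart y1 y2 y3"
      "?u - \<mu> *\<^sub>R ?v \<in> chart x1 x2 x3"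
      using pq(2,3) by (simp_all add: lag_infinity_eq chart_def)
    ultimately show "\<exists>v\<in>lag_infinity. v \<noteq> 0 \<and>
       (\<exists>u\<in>chart 0 0 0. v - u \<in> chart y1 y2 y3 \<and> u - \<mu> *\<^sub>R v \<in> chart x1 x2 x3)"
      by blast
  qed
  finally show "\<mu> \<in> cr_eigenvalues lag_infinity (chart x1 x2 x3) (chart y1 y2 y3) (chart 0 0 0) \<longleftrightarrow>
    \<mu> \<in> pencil_eigenvalues x1 x2 x3 y1 y2 y3" .
qed

lemma cr_eigenvalues_image_chart:
  assumes "g \<in> carrier Sp4" "y1 * y3 - y2\<^sup>2 \<noteq> 0"
  shows "cr_eigenvalues ((*v) g ` lag_infinity) ((*v) g ` chart x1 x2 x3) ((*v) g ` chart y1 y2 y3)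
    ((*v) g ` chart 0 0 0) = pencil_eigenvalues x1 x2 x3 y1 y2 y3"
  using assms by (simp only: cr_eigenvalues_image cr_eigenvalues_chart lagrangian_infinity
      lagrangian_chart transverse_infinity_chart transverse_zero_chart not_False_eq_True simp_thms)

section \<open>Diagonal configurations\<close>

text \<open>The diagonal copy of SO(2), acting alike on upper and lower halves. It fixes
  \<open>lag_infinity\<close> and all scalar matrices, hence the base triple.\<close>

definition rotation :: "real \<Rightarrow> real \<Rightarrow> real^4^4" where
  "rotation c s = vector [vector [c, - s, 0,   0],
                          vector [s,   c, 0,   0],
                          vector [0,   0, c, - s],
                          vector [0,   0, s,   c]]"

lemma rotation_Sp4: "c\<^sup>2 + s\<^sup>2 = 1 \<Longrightarrow> rotation c s \<in> carrier Sp4"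
  by (simp add: Sp4_iff vec4_eq_iff matrix_matrix_mult_4 transpose_def rotation_def symp_mat_def
      power2_eq_square add.commute)

lemma rotation_infinity:
  assumes "c\<^sup>2 + s\<^sup>2 = 1"
  shows "(*v) (rotation c s) ` lag_infinity = lag_infinity"
  by (intro lagrangian_subset_eq lagrangian_image rotation_Sp4 assms lagrangian_infinity)
     (auto simp: lag_infinity_eq matrix_vector_mult_4 rotation_def)

text \<open>With R the 2 by 2 rotation, the new parameters are the entries of the conjugate of M by
  R; applying R to upper = (Id - M) lower gives this.\<close>

lemma rotation_chart:
  assumes cs: "c\<^sup>2 + s\<^sup>2 = 1"
  shows "(*v) (rotation c s) ` chart x y z =
    chart (c\<^sup>2 * x - 2 * c * s * y + s\<^sup>2 * z) (c * s * (x - z) + (c\<^sup>2 - s\<^sup>2) * y)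
          (s\<^sup>2 * x + 2 * c * s * y + c\<^sup>2 * z)"
proof (intro lagrangian_subset_eq lagrangian_image rotation_Sp4 cs lagrangian_chart image_subsetI)
  fix v assume "v \<in> chart x y z"
  then have "v $ 1 = v $ 3 - (x * v $ 3 + y * v $ 4)" "v $ 2 = v $ 4 - (y * v $ 3 + z * v $ 4)"
    by (simp_all add: chart_def)
  with cs have
    "c * v $ 1 - s * v $ 2 = (c * v $ 3 - s * v $ 4) -
      ((c\<^sup>2 * x - 2 * c * s * y + s\<^sup>2 * z) * (c * v $ 3 - s * v $ 4) +
       (c * s * (x - z) + (c\<^sup>2 - s\<^sup>2) * y) * (s * v $ 3 + c * v $ 4))"
    "s * v $ 1 + c * v $ 2 = (s * v $ 3 + c * v $ 4) -
      ((c * s * (x - z) + (c\<^sup>2 - s\<^sup>2) * y) * (c * v $ 3 - s * v $ 4) +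
       (s\<^sup>2 * x + 2 * c * s * y + c\<^sup>2 * z) * (s * v $ 3 + c * v $ 4))"
    by algebra+
  then show "rotation c s *v v \<in> chart (c\<^sup>2 * x - 2 * c * s * y + s\<^sup>2 * z) (c * s * (x - z) + (c\<^sup>2 - s\<^sup>2) * y)
          (s\<^sup>2 * x + 2 * c * s * y + c\<^sup>2 * z)"
    by (simp add: chart_def matrix_vector_mult_4 rotation_def)
qed

text \<open>The scalars \<open>a\<close> and \<open>b\<close> allow the same rotation to be applied to every matrix in
  the pencil spanned by \<open>Id\<close> and a given symmetric matrix.\<close>

lemma diagonalize_chart:
  obtains g m1 m2 where "g \<in> carrier Sp4" "m1 \<le> m2" "(*v) g ` lag_infinity = lag_infinity"
    "\<And>a b. (*v) g ` chart (a + b * x) (b * y) (a + b * z) = chart (a + b * m1) 0 (a + b * m2)"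
proof -
  \<comment> \<open>The traceless part of the matrix, read as a complex number. A rotation by t
    turns it through 2 t, so half the argument removes the off-diagonal entry.\<close>
  define w where "w = Complex ((z - x) / 2) y"
  define r t where "r = cmod w" "t = Arg w / 2"
  define c s where "c = cos t" "s = sin t"
  have cs: "c\<^sup>2 + s\<^sup>2 = 1"
    by (simp add: c_s_def)
  have "w = rcis r (2 * t)"
    by (simp add: r_t_def rcis_cmod_Arg)
  then have "Re w = r * cos (2 * t)" "Im w = r * sin (2 * t)"
    by simp_all
  then have x: "x = z - 2 * r * (c\<^sup>2 - s\<^sup>2)" and y: "y = 2 * r * s * c"
    by (simp_all add: w_def cos_double sin_double c_s_def)
  \<comment> \<open>Half the trace; the eigenvalues are m - r and m + r, ordered because the modulus
    r is nonnegative.\<close>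
  define m where "m = z - r * (c\<^sup>2 - s\<^sup>2)"
  have "(*v) (rotation c s) ` chart (a + b * x) (b * y) (a + b * z) =
      chart (a + b * (m - r)) 0 (a + b * (m + r))" for a b
  proof -
    have "c\<^sup>2 * (a + b * x) - 2 * c * s * (b * y) + s\<^sup>2 * (a + b * z) = a + b * (m - r)"
      "c * s * ((a + b * x) - (a + b * z)) + (c\<^sup>2 - s\<^sup>2) * (b * y) = 0"
      "s\<^sup>2 * (a + b * x) + 2 * c * s * (b * y) + c\<^sup>2 * (a + b * z) = a + b * (m + r)"
      using cs x y m_def by algebra+
    then show ?thesis
      by (simp only: rotation_chart[OF cs])
  qed
  moreover have "m - r \<le> m + r"
    by (simp add: r_t_def)
  ultimately show thesis
    using that rotation_Sp4[OF cs] rotation_infinity[OF cs] by blast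
qed

text \<open>The embedding of two copies of SL(2) acting on the symplectic planes spanned by
  coordinates 1, 3 and by coordinates 2, 4.\<close>

definition sl2_pair ::
    "real \<Rightarrow> real \<Rightarrow> real \<Rightarrow> real \<Rightarrow> real \<Rightarrow> real \<Rightarrow> real \<Rightarrow> real \<Rightarrow> real^4^4" where
  "sl2_pair a b c d a' b' c' d' = vector [vector [a,  0, b,  0],
                                          vector [0, a', 0, b'],
                                          vector [c,  0, d,  0],
                                          vector [0, c', 0, d']]"

lemma sl2_pair_Sp4:
  "a * d - b * c = 1 \<Longrightarrow> a' * d' - b' * c' = 1 \<Longrightarrow> sl2_pair a b c d a' b' c' d' \<in> carrier Sp4"
  by (simp add: Sp4_iff vec4_eq_iff matrix_matrix_mult_4 transpose_def sl2_pair_def symp_mat_def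
      algebra_simps)

text \<open>A unimodular matrix whose Moebius action sends infinity, 0, 1 to 1 - x, 1 - y, 1 - z. It
  exists because these three points are in the right cyclic order.\<close>

lemma sl2_triple:
  fixes x y z :: real
  assumes "z < y" "y < x"
  obtains a b c d where "a * d - b * c = 1" "a = (1 - x) * c" "b = (1 - y) * d" "a + b = (1 - z) * (c + d)"
proof -
  \<comment> \<open>The condition on the third point fixes the ratio of \<open>c\<close> to
    \<open>d\<close>. The determinant is then d^2 (y - z) (x - y) / (x - z), and the order of the
    points allows scaling it to 1.\<close>
  define d where "d = sqrt ((x - z) / ((y - z) * (x - y)))"
  define c where "c = - d * (y - z) / (x - z)"
  have d2: "d\<^sup>2 = (x - z) / ((y - z) * (x - y))"
    using assms by (simp add: d_def)
  have cx: "c * (x - z) = - d * (y - z)"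
    using assms by (simp add: c_def)
  have "(1 - x) * c * d - (1 - y) * d * c = d\<^sup>2 * (y - z) * (x - y) / (x - z)"
  proof -
    have "((1 - x) * c * d - (1 - y) * d * c) * (x - z) = d\<^sup>2 * (y - z) * (x - y)"
      using cx by algebra
    with assms show ?thesis
      by (simp add: eq_divide_eq)
  qed
  also have "\<dots> = 1"
    using assms by (simp add: d2)
  finally have "(1 - x) * c * d - (1 - y) * d * c = 1" .
  moreover have "(1 - x) * c + (1 - y) * d = (1 - z) * (c + d)"
    using cx by (simp add: algebra_simps)
  ultimately show thesis
    using that by blast
qed

text \<open>Diagonal charts split along the two symplectic planes, so one SL(2) matrix in each plane
  carries the base triple to the given one.\<close>

lemma maximal_triple_diagonal:
  assumes "z < y" "y < x" "z' < y'" "y' < x'"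
  shows "maximal_triple (chart x 0 x') (chart y 0 y') (chart z 0 z')"
proof -
  obtain a b c d where h: "a * d - b * c = 1" "a = (1 - x) * c" "b = (1 - y) * d" "a + b = (1 - z) * (c + d)"
    using sl2_triple[OF assms(1,2)] .
  obtain a' b' c' d' where k: "a' * d' - b' * c' = 1" "a' = (1 - x') * c'" "b' = (1 - y') * d'"
    "a' + b' = (1 - z') * (c' + d')"
    using sl2_triple[OF assms(3,4)] .
  let ?g = "sl2_pair a b c d a' b' c' d'"
  have g: "?g \<in> carrier Sp4"
    using h(1) k(1) by (rule sl2_pair_Sp4)
  have "(*v) ?g ` lag_infinity = chart x 0 x'"
    by (intro lagrangian_subset_eq lagrangian_image g lagrangian_infinity lagrangian_chart)
       (auto simp: lag_infinity_eq chart_def matrix_vector_mult_4 sl2_pair_def h(2) k(2) algebra_simps)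
  moreover have "(*v) ?g ` chart 1 0 1 = chart y 0 y'"
    by (intro lagrangian_subset_eq lagrangian_image g lagrangian_chart)
       (auto simp: chart_def matrix_vector_mult_4 sl2_pair_def h(3) k(3) algebra_simps)
  moreover have "(*v) ?g ` chart 0 0 0 = chart z 0 z'"
  proof (intro lagrangian_subset_eq lagrangian_image g lagrangian_chart image_subsetI)
    fix v assume "v \<in> chart 0 0 0"
    moreover have "a * p + b * p = (c * p + d * p) - z * (c * p + d * p)"
      "a' * p + b' * p = (c' * p + d' * p) - z' * (c' * p + d' * p)" for p
      using h(4) k(4) by algebra+
    ultimately show "?g *v v \<in> chart z 0 z'"
      by (simp add: chart_def matrix_vector_mult_4 sl2_pair_def)
  qed
  ultimately show ?thesis
    unfolding maximal_triple_iff using g by metis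
qed

text \<open>The same with the first point at infinity: each factor is the affine map t to (y - z) t
  + (1 - y), scaled to determinant 1.\<close>

lemma maximal_triple_infinity_diagonal:
  assumes "z < y" "z' < y'"
  shows "maximal_triple lag_infinity (chart y 0 y') (chart z 0 z')"
proof -
  define d d' where "d = 1 / sqrt (y - z)" "d' = 1 / sqrt (y' - z')"
  define a a' where "a = (y - z) * d" "a' = (y' - z') * d'"
  have [simp]: "a * d = 1" "a' * d' = 1"
    using assms by (simp_all add: d_d'_def a_a'_def)
  let ?g = "sl2_pair a ((1 - y) * d) 0 d a' ((1 - y') * d') 0 d'"
  have g: "?g \<in> carrier Sp4"
    by (rule sl2_pair_Sp4) simp_all
  have "(*v) ?g ` lag_infinity = lag_infinity"
    by (intro lagrangian_subset_eq lagrangian_image g lagrangian_infinity)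
       (auto simp: lag_infinity_eq matrix_vector_mult_4 sl2_pair_def)
  moreover have "(*v) ?g ` chart 1 0 1 = chart y 0 y'"
    by (intro lagrangian_subset_eq lagrangian_image g lagrangian_chart)
       (auto simp: chart_def matrix_vector_mult_4 sl2_pair_def algebra_simps)
  moreover have "(*v) ?g ` chart 0 0 0 = chart z 0 z'"
    by (intro lagrangian_subset_eq lagrangian_image g lagrangian_chart)
       (auto simp: chart_def matrix_vector_mult_4 sl2_pair_def a_a'_def algebra_simps)
  ultimately show ?thesis
    unfolding maximal_triple_iff using g by metis
qed

section \<open>Hexagons up to isometry\<close>

lemma carrier_PSp4: "carrier PSp4 = (\<lambda>g. {g, - g}) ` carrier Sp4"
proof -
  have "(- mat 1) ** g = - g" for g :: "real^4^4"
    by (simp add: vec4_eq_iff matrix_matrix_mult_4 mat_def)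
  then show ?thesis
    by (auto simp: PSp4_def FactGroup_def RCOSETS_def r_coset_def Sp4_def)
qed

text \<open>Subspaces are closed under negation, so both members of the coset give the same
  image.\<close>

lemma psp_image_eq:
  assumes "lagrangian l"
  shows "psp_image {g, - g} l = (*v) g ` l"
proof -
  have "- g *v v = g *v (- v)" for v
    by (simp add: vec4_eq_iff matrix_vector_mult_4)
  moreover have "- v \<in> l" if "v \<in> l" for v
    using assms that by (simp add: lagrangian_def subspace_neg)
  ultimately show ?thesis
    by (auto simp: psp_image_def)
qed

fun hex_image :: "real^4^4 \<Rightarrow> hexagon \<Rightarrow> hexagon" where
  "hex_image g (P, A, B, C, D, Q) =
     ((*v) g ` P, (*v) g ` A, (*v) g ` B, (*v) g ` C, (*v) g ` D, (*v) g ` Q)"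

lemma hex_image_mult: "hex_image (g ** h) x = hex_image g (hex_image h x)"
  by (cases x) (simp only: hex_image.simps image_mult)

fun lagrangian_hex :: "hexagon \<Rightarrow> bool" where
  "lagrangian_hex (P, A, B, C, D, Q) \<longleftrightarrow>
     lagrangian P \<and> lagrangian A \<and> lagrangian B \<and> lagrangian C \<and> lagrangian D \<and> lagrangian Q"

lemma lagrangian_hex_image: "g \<in> carrier Sp4 \<Longrightarrow> lagrangian_hex x \<Longrightarrow> lagrangian_hex (hex_image g x)"
  by (cases x) (simp add: lagrangian_image)

lemma orbit_eq:
  assumes "lagrangian_hex x"
  shows "orbit PSp4 hex_act x = (\<lambda>g. hex_image g x) ` carrier Sp4"
proof -
  have "hex_act {g, - g} x = hex_image g x" for g
    using assms by (cases x) (simp add: psp_image_eq)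
  moreover have "orbit PSp4 hex_act x = (\<lambda>\<Gamma>. hex_act \<Gamma> x) ` carrier PSp4"
    by (auto simp only: orbit_def)
  ultimately show ?thesis
    by (simp add: carrier_PSp4 image_image)
qed

text \<open>Right translation by \<open>g\<close> permutes the group and thus only reindexes the
  orbit.\<close>

lemma orbit_hex_image:
  assumes "lagrangian_hex x" "g \<in> carrier Sp4"
  shows "orbit PSp4 hex_act (hex_image g x) = orbit PSp4 hex_act x"
proof -
  obtain h where h: "h \<in> carrier Sp4" "h ** g = mat 1"
    using Sp4_inverse[OF assms(2)] by blast
  have "(\<lambda>k. k ** g) ` carrier Sp4 = carrier Sp4"
  proof (intro equalityI image_subsetI subsetI Sp4_mult assms(2))
    fix k assume "k \<in> carrier Sp4"
    then show "k \<in> (\<lambda>k. k ** g) ` carrier Sp4"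
      using h by (intro image_eqI[of _ _ "k ** h"]) (simp_all add: Sp4_mult matrix_mul_assoc[symmetric])
  qed
  then have "(\<lambda>k. hex_image k x) ` (\<lambda>k. k ** g) ` carrier Sp4 = (\<lambda>k. hex_image k x) ` carrier Sp4"
    by (simp only:)
  then show ?thesis
    unfolding orbit_eq[OF assms(1)] orbit_eq[OF lagrangian_hex_image[OF assms(2,1)]]
    by (simp only: image_image hex_image_mult)
qed

lemma maximal_tuple_image:
  assumes "g \<in> carrier Sp4" "maximal_tuple ls"
  shows "maximal_tuple (map ((`) ((*v) g)) ls)"
  using assms by (auto simp: maximal_tuple_def intro: maximal_triple_image)

lemma maximal_tuple_diagonal:
  assumes "sorted_wrt (\<lambda>p q. fst q < fst p \<and> snd q < snd p) ds"
  shows "maximal_tuple (lag_infinity # map (\<lambda>p. chart (fst p) 0 (snd p)) ds)"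
  unfolding maximal_tuple_def
proof (intro allI impI)
  fix i j k
  let ?ls = "lag_infinity # map (\<lambda>p. chart (fst p) 0 (snd p)) ds"
  assume ijk: "i < j \<and> j < k \<and> k < length ?ls"
  have less: "fst (ds ! n) < fst (ds ! m) \<and> snd (ds ! n) < snd (ds ! m)" if "m < n" "n < length ds" for m n
    using sorted_wrt_nth_less[OF assms that] .
  \<comment> \<open>Only the first index can hit \<open>lag_infinity\<close>; shifting the other two
    by one gives positions in \<open>ds\<close>.\<close>
  obtain j' k' where jk: "j = Suc j'" "k = Suc k'"
    using ijk by (metis gr_implies_not0 not0_implies_Suc less_trans)
  show "maximal_triple (?ls ! i) (?ls ! j) (?ls ! k)"
  proof (cases i)
    case 0
    then show ?thesis
      using ijk less by (simp add: jk maximal_triple_infinity_diagonal)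
  next
    case (Suc i')
    then show ?thesis
      using ijk less by (simp add: jk maximal_triple_diagonal)
  qed
qed

section \<open>Diagonal normal forms and their lengths\<close>

definition weyl_chamber :: "(real \<times> real) set" where
  "weyl_chamber = {(x1, x2). x1 \<ge> x2 \<and> x2 > 0}"

text \<open>The exponents are partial sums, so that ratios of consecutive diagonal entries are the
  exponentials of the individual lengths.\<close>

fun normal_hex :: "(real \<times> real) \<times> (real \<times> real) \<times> (real \<times> real) \<Rightarrow> hexagon" where
  "normal_hex ((b, b'), (c, c'), (d, d')) =
     (lag_infinity, chart 1 0 1, chart (exp (- b)) 0 (exp (- b')),
      chart (exp (- b - c)) 0 (exp (- b' - c')), chart (exp (- b - c - d)) 0 (exp (- b' - c' - d')),
      chart 0 0 0)"

lemma lagrangian_normal_hex: "lagrangian_hex (normal_hex t)"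
  by (cases t rule: normal_hex.cases) (simp add: lagrangian_infinity lagrangian_chart)

text \<open>Positive lengths make both sequences of diagonal entries strictly decreasing from 1 to
  0.\<close>

lemma maximal_normal_hex:
  assumes "t \<in> weyl_chamber \<times> weyl_chamber \<times> weyl_chamber" "normal_hex t = (P, A, B, C, D, Q)"
  shows "maximal_tuple [P, A, B, C, D, Q]"
proof -
  obtain b b' c c' d d' where t: "t = ((b, b'), (c, c'), (d, d'))"
    by (cases t rule: normal_hex.cases)
  show ?thesis
    using assms maximal_tuple_diagonal[of "[(1, 1), (exp (- b), exp (- b')), (exp (- b - c), exp (- b' - c')),
        (exp (- b - c - d), exp (- b' - c' - d')), (0, 0)]"]
    by (auto simp: t weyl_chamber_def)
qed

lemma cr_eigenvalues_diagonal:
  assumes "g \<in> carrier Sp4" "y \<noteq> 0" "y' \<noteq> 0"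
  shows "cr_eigenvalues ((*v) g ` lag_infinity) ((*v) g ` chart x 0 x') ((*v) g ` chart y 0 y')
    ((*v) g ` chart 0 0 0) = {x / y, x' / y'}"
  using assms by (simp add: cr_eigenvalues_image_chart pencil_eigenvalues_diagonal)

lemma weyl_length_exp:
  assumes "cr_eigenvalues P X Y Q = {exp l, exp l'}" "(l, l') \<in> weyl_chamber"
  shows "weyl_length P X Y Q = (l, l')" "generic P X Y Q \<longleftrightarrow> (l, l') \<in> weyl_regular"
  using assms by (auto simp: weyl_length_def generic_def weyl_chamber_def weyl_regular_def
      max_def min_def card_insert_if)

text \<open>Cross-ratio eigenvalues are invariant under \<open>g\<close>, and for diagonal charts
  they are ratios of consecutive entries, where the partial sums telescope.\<close>

lemma normal_hex_lengths:
  assumes g: "g \<in> carrier Sp4" and t: "(tb, tc, td) \<in> weyl_chamber \<times> weyl_chamber \<times> weyl_chamber"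
    and h: "hex_image g (normal_hex (tb, tc, td)) = (P, A, B, C, D, Q)"
  shows "hex_lengths (P, A, B, C, D, Q) = (tb, tc, td)"
    and "generic P A B Q \<longleftrightarrow> tb \<in> weyl_regular"
    and "generic P B C Q \<longleftrightarrow> tc \<in> weyl_regular"
    and "generic P C D Q \<longleftrightarrow> td \<in> weyl_regular"
proof -
  obtain b b' c c' d d' where bcd: "tb = (b, b')" "tc = (c, c')" "td = (d, d')"
    by (metis surj_pair)
  have eqs: "P = (*v) g ` lag_infinity" "A = (*v) g ` chart 1 0 1"
    "B = (*v) g ` chart (exp (- b)) 0 (exp (- b'))"
    "C = (*v) g ` chart (exp (- b - c)) 0 (exp (- b' - c'))"
    "D = (*v) g ` chart (exp (- b - c - d)) 0 (exp (- b' - c' - d'))" "Q = (*v) g ` chart 0 0 0"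
    using h by (simp_all add: bcd)
  have exps: "1 / exp (- u) = exp u" "exp u / exp (u - v) = exp v" for u v :: real
    by (simp_all add: exp_minus exp_diff inverse_eq_divide)
  have "cr_eigenvalues P A B Q = {exp b, exp b'}" "cr_eigenvalues P B C Q = {exp c, exp c'}"
    "cr_eigenvalues P C D Q = {exp d, exp d'}"
    unfolding eqs cr_eigenvalues_diagonal[OF g exp_not_eq_zero exp_not_eq_zero]
    by (simp_all only: exps)
  note E = this[THEN weyl_length_exp(1)] this[THEN weyl_length_exp(2)]
  show "hex_lengths (P, A, B, C, D, Q) = (tb, tc, td)"
    "generic P A B Q \<longleftrightarrow> tb \<in> weyl_regular"
    "generic P B C Q \<longleftrightarrow> tc \<in> weyl_regular"
    "generic P C D Q \<longleftrightarrow> td \<in> weyl_regular"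
    using t by (simp_all add: bcd E)
qed

text \<open>The inverse of the desired bijection sends \<open>t\<close> to the orbit
  \<open>N t\<close> of its normal hexagon: the lengths are constantly \<open>t\<close> on this
  orbit, and by \<open>normal\<close> every orbit arises in this way.\<close>

lemma lengths_parametrizeI:
  assumes normal: "\<And>h. h \<in> H \<Longrightarrow> \<exists>t\<in>T. \<exists>g\<in>carrier Sp4. h = hex_image g (normal_hex t)"
    and mem: "\<And>t. t \<in> T \<Longrightarrow> normal_hex t \<in> H"
    and T: "T \<subseteq> weyl_chamber \<times> weyl_chamber \<times> weyl_chamber"
  shows "lengths_parametrize H T"
proof -
  define N where "N t = orbit PSp4 hex_act (normal_hex t)" for t
  have lengths: "hex_lengths (hex_image g (normal_hex t)) = t" if "t \<in> T" "g \<in> carrier Sp4" for g t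
  proof -
    obtain tb tc td where t: "t = (tb, tc, td)"
      by (rule prod_cases3)
    obtain P A B C D Q where h: "hex_image g (normal_hex t) = (P, A, B, C, D, Q)"
      by (rule prod_cases6)
    have "(tb, tc, td) \<in> weyl_chamber \<times> weyl_chamber \<times> weyl_chamber"
      using that(1) T t by blast
    from normal_hex_lengths(1)[OF that(2) this h[unfolded t]] show ?thesis
      unfolding h by (simp only: t)
  qed
  have lengths': "hex_lengths h = t" if t: "t \<in> T" and h: "h \<in> N t" for h t
  proof -
    obtain g where "g \<in> carrier Sp4" "h = hex_image g (normal_hex t)"
      using h unfolding N_def orbit_eq[OF lagrangian_normal_hex] by blast
    with lengths[OF t] show ?thesis
      by (simp only:)
  qed
  \<comment> \<open>The choice of representative is harmless, since \<open>lengths'\<close> makes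
    the lengths constant on each \<open>N t\<close>.\<close>
  define F where "F X = hex_lengths (SOME h. h \<in> X)" for X
  have "N t \<noteq> {}" for t
    using Sp4_one by (auto simp: N_def orbit_eq[OF lagrangian_normal_hex])
  then have F: "F (N t) = t" if "t \<in> T" for t
    using that lengths' by (simp add: F_def some_in_eq)
  have orb: "\<exists>t\<in>T. orbit PSp4 hex_act h = N t \<and> hex_lengths h = t" if h: "h \<in> H" for h
  proof -
    obtain t g where "t \<in> T" "g \<in> carrier Sp4" "h = hex_image g (normal_hex t)"
      using normal[OF h] by blast
    with lengths orbit_hex_image[OF lagrangian_normal_hex] show ?thesis
      unfolding N_def by metis
  qed
  have orbs: "orbits PSp4 H hex_act = N ` T"
  proof
    show "orbits PSp4 H hex_act \<subseteq> N ` T"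
      using orb by (force simp: orbits_def)
    show "N ` T \<subseteq> orbits PSp4 H hex_act"
      using mem unfolding orbits_def N_def by blast
  qed
  have "bij_betw F (orbits PSp4 H hex_act) T"
    unfolding orbs by (rule bij_betwI[where g = N]) (auto simp: F)
  moreover have "F (orbit PSp4 hex_act h) = hex_lengths h" if "h \<in> H" for h
    using orb[OF that] F by auto
  ultimately show ?thesis
    unfolding lengths_parametrize_def by blast
qed

text \<open>If two of the three quadruples are not generic, then all matrices of a normalized hexagon
  lie in the pencil of \<open>Id\<close> and one symmetric matrix, hence are diagonalized by one rotation.\<close>

lemma diagonalize_hexagon:
  fixes b1 b2 b3 c1 c2 c3 d1 d2 d3 :: real
  assumes pos: "b1 > 0" "b1 * b3 - b2\<^sup>2 > 0" "c1 > 0" "c1 * c3 - c2\<^sup>2 > 0" "d1 > 0" "d1 * d3 - d2\<^sup>2 > 0"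
    and nongeneric:
      "(card (pencil_eigenvalues 1 0 1 b1 b2 b3) \<noteq> 2 \<and> card (pencil_eigenvalues b1 b2 b3 c1 c2 c3) \<noteq> 2) \<or>
       (card (pencil_eigenvalues 1 0 1 b1 b2 b3) \<noteq> 2 \<and> card (pencil_eigenvalues c1 c2 c3 d1 d2 d3) \<noteq> 2) \<or>
       (card (pencil_eigenvalues b1 b2 b3 c1 c2 c3) \<noteq> 2 \<and> card (pencil_eigenvalues c1 c2 c3 d1 d2 d3) \<noteq> 2)"
  obtains g b b' c c' d d' where "g \<in> carrier Sp4" "(*v) g ` lag_infinity = lag_infinity"
    "(*v) g ` chart 1 0 1 = chart 1 0 1" "(*v) g ` chart b1 b2 b3 = chart b 0 b'"
    "(*v) g ` chart c1 c2 c3 = chart c 0 c'" "(*v) g ` chart d1 d2 d3 = chart d 0 d'"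
    "(*v) g ` chart 0 0 0 = chart 0 0 0" "b \<le> b'" "b' * c \<le> b * c'" "c' * d \<le> c * d'"
proof -
  have pencil: "\<exists>k>0. y1 = k * x1 \<and> y2 = k * x2 \<and> y3 = k * x3"
    if x: "x1 > 0" and y: "y1 > 0" "y1 * y3 - y2\<^sup>2 > 0" and card: "card (pencil_eigenvalues x1 x2 x3 y1 y2 y3) \<noteq> 2"
    for x1 x2 x3 y1 y2 y3
  proof -
    obtain k where k: "x1 = k * y1" "x2 = k * y2" "x3 = k * y3"
      using card_pencil_eigenvalues[OF y card] .
    then have "k > 0"
      using x y(1) by (simp add: zero_less_mult_iff)
    with k show ?thesis
      by (intro exI[of _ "1 / k"]) simp
  qed
  \<comment> \<open>Each case is named after the matrix that gets diagonalized; the remaining ones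
    are scalar or multiples of it.\<close>
  consider
    (d) \<beta> \<gamma> where "\<beta> > 0" "\<gamma> > 0" "b1 = \<beta>" "b2 = 0" "b3 = \<beta>" "c1 = \<gamma>" "c2 = 0" "c3 = \<gamma>" |
    (c) \<beta> \<delta> where "\<beta> > 0" "b1 = \<beta>" "b2 = 0" "b3 = \<beta>" "d1 = \<delta> * c1" "d2 = \<delta> * c2" "d3 = \<delta> * c3" |
    (b) \<gamma> \<delta> where "c1 = \<gamma> * b1" "c2 = \<gamma> * b2" "c3 = \<gamma> * b3" "d1 = \<delta> * b1" "d2 = \<delta> * b2" "d3 = \<delta> * b3"
  proof -
    have B: "\<exists>k>0. b1 = k \<and> b2 = 0 \<and> b3 = k" if "card (pencil_eigenvalues 1 0 1 b1 b2 b3) \<noteq> 2"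
      using pencil[OF zero_less_one pos(1,2) that] by simp
    have C: "\<exists>k>0. c1 = k * b1 \<and> c2 = k * b2 \<and> c3 = k * b3"
      if "card (pencil_eigenvalues b1 b2 b3 c1 c2 c3) \<noteq> 2"
      using pencil[OF pos(1,3,4) that] .
    have D: "\<exists>k>0. d1 = k * c1 \<and> d2 = k * c2 \<and> d3 = k * c3"
      if "card (pencil_eigenvalues c1 c2 c3 d1 d2 d3) \<noteq> 2"
      using pencil[OF pos(3,5,6) that] .
    from nongeneric show thesis
    proof (elim disjE conjE)
      assume "card (pencil_eigenvalues 1 0 1 b1 b2 b3) \<noteq> 2" "card (pencil_eigenvalues b1 b2 b3 c1 c2 c3) \<noteq> 2"
      from B[OF this(1)] C[OF this(2)] obtain k l where
        "k > 0" "b1 = k" "b2 = 0" "b3 = k" "l > 0" "c1 = l * b1" "c2 = l * b2" "c3 = l * b3"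
        by blast
      then show thesis
        by (intro d[of k "l * k"]) simp_all
    next
      assume "card (pencil_eigenvalues 1 0 1 b1 b2 b3) \<noteq> 2" "card (pencil_eigenvalues c1 c2 c3 d1 d2 d3) \<noteq> 2"
      from B[OF this(1)] D[OF this(2)] c show thesis
        by blast
    next
      assume "card (pencil_eigenvalues b1 b2 b3 c1 c2 c3) \<noteq> 2" "card (pencil_eigenvalues c1 c2 c3 d1 d2 d3) \<noteq> 2"
      from C[OF this(1)] D[OF this(2)] obtain k l where
        "c1 = k * b1" "c2 = k * b2" "c3 = k * b3" "d1 = l * c1" "d2 = l * c2" "d3 = l * c3"
        by blast
      then show thesis
        by (intro b[of k "l * k"]) simp_all
    qed
  qed
  then show thesis
  proof cases
    case d
    obtain g m1 m2 where g: "g \<in> carrier Sp4" "m1 \<le> m2" "(*v) g ` lag_infinity = lag_infinity"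
      "\<And>a k. (*v) g ` chart (a + k * d1) (k * d2) (a + k * d3) = chart (a + k * m1) 0 (a + k * m2)"
      using diagonalize_chart[of d1 d2 d3] by metis
    have scalar: "(*v) g ` chart a 0 a = chart a 0 a" for a
      using g(4)[of a 0] by simp
    show thesis
      by (rule that[of g \<beta> \<beta> \<gamma> \<gamma> m1 m2])
        (use g scalar g(4)[of 0 1] d in \<open>simp_all add: mult_left_mono\<close>)
  next
    case c
    obtain g m1 m2 where g: "g \<in> carrier Sp4" "m1 \<le> m2" "(*v) g ` lag_infinity = lag_infinity"
      "\<And>a k. (*v) g ` chart (a + k * c1) (k * c2) (a + k * c3) = chart (a + k * m1) 0 (a + k * m2)"
      using diagonalize_chart[of c1 c2 c3] by metis
    have scalar: "(*v) g ` chart a 0 a = chart a 0 a" for a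
      using g(4)[of a 0] by simp
    show thesis
      by (rule that[of g \<beta> \<beta> m1 m2 "\<delta> * m1" "\<delta> * m2"])
        (use g scalar g(4)[of 0 1] g(4)[of 0 \<delta>] c in \<open>simp_all add: mult_left_mono\<close>)
  next
    case b
    obtain g m1 m2 where g: "g \<in> carrier Sp4" "m1 \<le> m2" "(*v) g ` lag_infinity = lag_infinity"
      "\<And>a k. (*v) g ` chart (a + k * b1) (k * b2) (a + k * b3) = chart (a + k * m1) 0 (a + k * m2)"
      using diagonalize_chart[of b1 b2 b3] by metis
    have scalar: "(*v) g ` chart a 0 a = chart a 0 a" for a
      using g(4)[of a 0] by simp
    show thesis
      by (rule that[of g m1 m2 "\<gamma> * m1" "\<gamma> * m2" "\<delta> * m1" "\<delta> * m2"])
        (use g scalar g(4)[of 0 1] g(4)[of 0 \<gamma>] g(4)[of 0 \<delta>] b in simp_all)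
  qed
qed

section \<open>Reduction of a maximal hexagon to normal form\<close>

lemma maximal_tupleD:
  "maximal_tuple ls \<Longrightarrow> i < j \<Longrightarrow> j < k \<Longrightarrow> k < length ls \<Longrightarrow> maximal_triple (ls ! i) (ls ! j) (ls ! k)"
  by (simp add: maximal_tuple_def)

text \<open>Leading minors of a positive definite form: its value at (1, 0) is \<open>x1\<close>,
  and at (x2, -x1) it is \<open>x1\<close> times the determinant.\<close>

lemma maximal_chart_pos:
  assumes "maximal_triple lag_infinity (chart x1 x2 x3) (chart 0 0 0)"
  shows "x1 > 0" "x1 * x3 - x2\<^sup>2 > 0"
proof -
  show x1: "x1 > 0"
    using maximal_triple_chart_less[OF assms, of 1 0] by simp
  have "0 < x1 * x2\<^sup>2 + 2 * x2 * x2 * (- x1) + x3 * (- x1)\<^sup>2"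
    using maximal_triple_chart_less[OF assms, of x2 "- x1"] x1 by simp
  also have "\<dots> = x1 * (x1 * x3 - x2\<^sup>2)"
    by algebra
  finally show "x1 * x3 - x2\<^sup>2 > 0"
    using x1 by (simp only: zero_less_mult_pos)
qed

lemma maximal_diagonal_less:
  assumes "maximal_triple lag_infinity (chart x 0 x') (chart y 0 y')"
  shows "y < x" "y' < x'"
  using maximal_triple_chart_less[OF assms, of 1 0] maximal_triple_chart_less[OF assms, of 0 1] by simp_all

text \<open>Maximality of (P, A, Q) supplies \<open>g\<close>. Pulled back by \<open>g\<close>,
  every other member is transverse to \<open>lag_infinity\<close> and so lies in the chart.\<close>

lemma normalize_hexagon:
  assumes max: "maximal_tuple [P, A, B, C, D, Q]"
  obtains g b1 b2 b3 c1 c2 c3 d1 d2 d3 where "g \<in> carrier Sp4"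
    "P = (*v) g ` lag_infinity" "A = (*v) g ` chart 1 0 1" "B = (*v) g ` chart b1 b2 b3"
    "C = (*v) g ` chart c1 c2 c3" "D = (*v) g ` chart d1 d2 d3" "Q = (*v) g ` chart 0 0 0"
proof -
  have "maximal_triple P A Q"
    using maximal_tupleD[OF max, of 0 1 5] by simp
  then obtain g where g: "g \<in> carrier Sp4" "P = (*v) g ` lag_infinity" "A = (*v) g ` chart 1 0 1"
    "Q = (*v) g ` chart 0 0 0"
    unfolding maximal_triple_iff by blast
  obtain h where h: "h \<in> carrier Sp4" "g ** h = mat 1" "h ** g = mat 1"
    using Sp4_inverse[OF g(1)] .
  have chart: "\<exists>x y z. X = (*v) g ` chart x y z" if X: "maximal_triple P X Q" for X
  proof -
    have "maximal_triple ((*v) h ` P) ((*v) h ` X) ((*v) h ` Q)"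
      by (rule maximal_triple_image[OF h(1) X])
    moreover have "(*v) h ` P = lag_infinity"
      unfolding g(2) by (simp only: image_mult[symmetric] h image_one)
    ultimately obtain x y z where "(*v) h ` X = chart x y z"
      unfolding maximal_triple_def using transverse_to_infinity[of "(*v) h ` X"] by metis
    then have "(*v) g ` chart x y z = X"
      by (simp only: image_mult[symmetric] h image_one flip: \<open>(*v) h ` X = chart x y z\<close>)
    then show ?thesis
      by blast
  qed
  have "maximal_triple P B Q" "maximal_triple P C Q" "maximal_triple P D Q"
    using maximal_tupleD[OF max, of 0 2 5] maximal_tupleD[OF max, of 0 3 5]
      maximal_tupleD[OF max, of 0 4 5] by simp_all
  from this[THEN chart] g that show thesis
    by blast
qed

text \<open>First \<open>g\<close> normalizes P, A, Q; then \<open>k\<close>, which fixes the base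
  triple, diagonalizes the rest. Maximality makes the diagonal entries decrease strictly, so their
  logarithms give admissible lengths.\<close>

lemma hexagon_normal_form:
  assumes max: "maximal_tuple [P, A, B, C, D, Q]"
    and nongeneric: "(\<not> generic P A B Q \<and> \<not> generic P B C Q) \<or> (\<not> generic P A B Q \<and> \<not> generic P C D Q) \<or>
      (\<not> generic P B C Q \<and> \<not> generic P C D Q)"
  obtains g tb tc td where "g \<in> carrier Sp4" "(tb, tc, td) \<in> weyl_chamber \<times> weyl_chamber \<times> weyl_chamber"
    "hex_image g (normal_hex (tb, tc, td)) = (P, A, B, C, D, Q)"
proof -
  obtain g b1 b2 b3 c1 c2 c3 d1 d2 d3 where g: "g \<in> carrier Sp4"
    and eqs: "P = (*v) g ` lag_infinity" "A = (*v) g ` chart 1 0 1" "B = (*v) g ` chart b1 b2 b3"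
    "C = (*v) g ` chart c1 c2 c3" "D = (*v) g ` chart d1 d2 d3" "Q = (*v) g ` chart 0 0 0"
    using normalize_hexagon[OF max] .
  obtain h where h: "h \<in> carrier Sp4" "g ** h = mat 1" "h ** g = mat 1"
    using Sp4_inverse[OF g] .
  have hg: "(*v) h ` (*v) g ` S = S" for S
    by (simp only: image_mult[symmetric] h image_one)
  have max': "maximal_tuple [lag_infinity, chart 1 0 1, chart b1 b2 b3, chart c1 c2 c3, chart d1 d2 d3, chart 0 0 0]"
    using maximal_tuple_image[OF h(1) max] by (simp only: eqs list.map hg)
  have "maximal_triple lag_infinity (chart b1 b2 b3) (chart 0 0 0)"
    "maximal_triple lag_infinity (chart c1 c2 c3) (chart 0 0 0)"
    "maximal_triple lag_infinity (chart d1 d2 d3) (chart 0 0 0)"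
    using maximal_tupleD[OF max', of 0 2 5] maximal_tupleD[OF max', of 0 3 5]
      maximal_tupleD[OF max', of 0 4 5] by simp_all
  \<comment> \<open>Facts 1 to 3 concern the leading entries for B, C, D, facts 4 to 6 the
    determinants.\<close>
  note pos = this[THEN maximal_chart_pos(1)] this[THEN maximal_chart_pos(2)]
  have generic: "generic ((*v) g ` lag_infinity) ((*v) g ` chart x1 x2 x3) ((*v) g ` chart y1 y2 y3)
      ((*v) g ` chart 0 0 0) \<longleftrightarrow> card (pencil_eigenvalues x1 x2 x3 y1 y2 y3) = 2"
    if "y1 * y3 - y2\<^sup>2 > 0" for x1 x2 x3 y1 y2 y3
    using that by (simp add: generic_def cr_eigenvalues_image_chart[OF g])
  obtain k b b' c c' d d' where k: "k \<in> carrier Sp4"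
    and images: "(*v) k ` lag_infinity = lag_infinity"
    "(*v) k ` chart 1 0 1 = chart 1 0 1" "(*v) k ` chart b1 b2 b3 = chart b 0 b'"
    "(*v) k ` chart c1 c2 c3 = chart c 0 c'" "(*v) k ` chart d1 d2 d3 = chart d 0 d'"
    "(*v) k ` chart 0 0 0 = chart 0 0 0"
    and order: "b \<le> b'" "b' * c \<le> b * c'" "c' * d \<le> c * d'"
    using diagonalize_hexagon[OF pos(1,4,2,5,3,6)] nongeneric
    unfolding eqs generic[OF pos(4)] generic[OF pos(5)] generic[OF pos(6)] by blast
  have max'': "maximal_tuple [lag_infinity, chart 1 0 1, chart b 0 b', chart c 0 c', chart d 0 d', chart 0 0 0]"
    using maximal_tuple_image[OF k max'] by (simp only: images list.map)
  have less: "b < 1" "b' < 1" "c < b" "c' < b'" "d < c" "d' < c'" "0 < d" "0 < d'"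
    using maximal_tupleD[OF max'', of 0 1 2, simplified] maximal_tupleD[OF max'', of 0 2 3, simplified]
      maximal_tupleD[OF max'', of 0 3 4, simplified] maximal_tupleD[OF max'', of 0 4 5, simplified]
    by (auto dest: maximal_diagonal_less)
  \<comment> \<open>Logarithms of the ratios of consecutive diagonal entries, starting from the
    entries 1 of A.\<close>
  let ?tb = "(- ln b, - ln b')" and ?tc = "(ln b - ln c, ln b' - ln c')" and ?td = "(ln c - ln d, ln c' - ln d')"
  \<comment> \<open>In logarithms, the product inequalities say that the first component of
    \<open>?tc\<close> and of \<open>?td\<close> is the larger one.\<close>
  have "ln (b' * c) \<le> ln (b * c')" "ln (c' * d) \<le> ln (c * d')"
    using less order by simp_all
  then have "(?tb, ?tc, ?td) \<in> weyl_chamber \<times> weyl_chamber \<times> weyl_chamber"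
    using less order by (simp add: weyl_chamber_def ln_mult)
  moreover obtain k' where k': "k' \<in> carrier Sp4" "k ** k' = mat 1" "k' ** k = mat 1"
    using Sp4_inverse[OF k] .
  moreover have "hex_image (g ** k') (normal_hex (?tb, ?tc, ?td)) = (P, A, B, C, D, Q)"
  proof -
    have "normal_hex (?tb, ?tc, ?td) = (lag_infinity, chart 1 0 1, chart b 0 b', chart c 0 c', chart d 0 d', chart 0 0 0)"
      using less by simp
    also have "\<dots> = hex_image k (lag_infinity, chart 1 0 1, chart b1 b2 b3, chart c1 c2 c3, chart d1 d2 d3, chart 0 0 0)"
      by (simp only: hex_image.simps images)
    finally show ?thesis
      \<comment> \<open>As \<open>k\<close> leads from the normalized hexagon to its diagonal form,
        \<open>k'\<close> has to undo it before \<open>g\<close> is applied.\<close>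
      by (simp only: hex_image_mult[symmetric] matrix_mul_assoc[symmetric] k' matrix_mul_rid)
        (simp only: hex_image.simps eqs)
  qed
  ultimately show thesis
    using that Sp4_mult g by blast
qed

section \<open>The three types as instances of one statement\<close>

definition weyl_part :: "bool \<Rightarrow> (real \<times> real) set" where
  "weyl_part p = (if p then weyl_regular else weyl_diagonal)"

text \<open>Chamber vectors off the diagonal are the regular ones, so a genericity flag selects a
  part of the chamber.\<close>

lemma mem_weyl_part_iff: "t \<in> weyl_part p \<longleftrightarrow> t \<in> weyl_chamber \<and> (t \<in> weyl_regular \<longleftrightarrow> p)"
  by (auto simp: weyl_part_def weyl_regular_def weyl_diagonal_def weyl_chamber_def)

text \<open>Two false flags guarantee a diagonal normal form. Its lengths are regular exactly where
  the quadruples are generic, which matches the flags on both sides.\<close>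

lemma lengths_parametrize_generic:
  assumes two: "(\<not> p \<and> \<not> q) \<or> (\<not> p \<and> \<not> r) \<or> (\<not> q \<and> \<not> r)"
  shows "lengths_parametrize
    {(P, A, B, C, D, Q). maximal_tuple [P, A, B, C, D, Q] \<and>
       (generic P A B Q \<longleftrightarrow> p) \<and> (generic P B C Q \<longleftrightarrow> q) \<and> (generic P C D Q \<longleftrightarrow> r)}
    (weyl_part p \<times> weyl_part q \<times> weyl_part r)"
  (is "lengths_parametrize ?H ?T")
proof (rule lengths_parametrizeI)
  fix h assume "h \<in> ?H"
  moreover obtain P A B C D Q where h: "h = (P, A, B, C, D, Q)"
    by (rule prod_cases6)
  ultimately have max: "maximal_tuple [P, A, B, C, D, Q]"
    and gen: "generic P A B Q \<longleftrightarrow> p" "generic P B C Q \<longleftrightarrow> q" "generic P C D Q \<longleftrightarrow> r"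
    by simp_all
  obtain g tb tc td where gt: "g \<in> carrier Sp4"
    "(tb, tc, td) \<in> weyl_chamber \<times> weyl_chamber \<times> weyl_chamber"
    "hex_image g (normal_hex (tb, tc, td)) = (P, A, B, C, D, Q)"
    using hexagon_normal_form[OF max two[folded gen]] .
  have "(tb, tc, td) \<in> ?T"
    using gt(2) normal_hex_lengths(2-4)[OF gt] gen by (simp add: mem_weyl_part_iff)
  with gt(1) show "\<exists>t\<in>?T. \<exists>g\<in>carrier Sp4. h = hex_image g (normal_hex t)"
    unfolding h gt(3)[symmetric] by blast
next
  fix t assume "t \<in> ?T"
  moreover obtain tb tc td where t: "t = (tb, tc, td)"
    by (rule prod_cases3)
  ultimately have chamber: "(tb, tc, td) \<in> weyl_chamber \<times> weyl_chamber \<times> weyl_chamber"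
    and reg: "tb \<in> weyl_regular \<longleftrightarrow> p" "tc \<in> weyl_regular \<longleftrightarrow> q" "td \<in> weyl_regular \<longleftrightarrow> r"
    by (simp_all add: mem_weyl_part_iff)
  obtain P A B C D Q where N: "normal_hex (tb, tc, td) = (P, A, B, C, D, Q)"
    by (rule prod_cases6)
  then have "hex_image (mat 1) (normal_hex (tb, tc, td)) = (P, A, B, C, D, Q)"
    by (simp only: hex_image.simps image_one)
  from normal_hex_lengths(2-4)[OF Sp4_one chamber this] maximal_normal_hex[OF chamber N] reg
  show "normal_hex t \<in> ?H"
    unfolding t N by simp
qed (auto simp: mem_weyl_part_iff)

theorem proposition4p21:
  shows "lengths_parametrize hex_type2_1 (weyl_diagonal \<times> weyl_diagonal \<times> weyl_regular) \<and>
         lengths_parametrize hex_type2_2 (weyl_diagonal \<times> weyl_regular \<times> weyl_diagonal) \<and>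
         lengths_parametrize hex_type2_3 (weyl_regular \<times> weyl_diagonal \<times> weyl_diagonal)"
  using lengths_parametrize_generic[of False False True] lengths_parametrize_generic[of False True False]
    lengths_parametrize_generic[of True False False]
  by (simp add: weyl_part_def hex_type2_1_def hex_type2_2_def hex_type2_3_def)

end
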